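(* Let $J\subset\mathcal P=k[X_0,\dots,X_n]$ be a strongly stable monomial ideal with monomial basis $B_J$ and let $I$ be the homogeneous ideal generated by a $J$-set $G=\{f_\alpha=X^\alpha-\sum c_{\alpha\gamma}X^\gamma\mid X^\alpha\in B_J\}$. Then $$I\in B\mathcal St(J)\iff \text{for all } f_\alpha,f_{\alpha'}\in G:\ S(f_\alpha,f_{\alpha'})\stackrel{G^{**}}{\longrightarrow}_+0 .$$
   Context: $k$ is an algebraically closed field of any characteristic, $\mathcal P=k[X_0,\dots,X_n]$ with the variables ordered $X_0<X_1<\dots<X_n$; $X^\alpha=X_0^{\alpha_0}\cdots X_n^{\alpha_n}$. For a monomial ideal $J$, $B_J$ is its set of minimal monomial generators, $\mathcal N(J)$ is the set of monomials not in $J$, $J_m$ is the degree $m$ part. Strongly stable: an up elementary move replaces a monomial $X^\delta X_i$ by $X^\delta X_j$ with $X_i<X_j$; write $X^\alpha\prec_B X^\beta$ if $X^\beta$ is obtained from $X^\alpha$ by a sequence of up elementary moves. $J$ is strongly stable if it contains every monomial $X^\alpha$ with $X^\alpha\succ_B X^\beta$ for some monomial $X^\beta\in J$. $B\mathcal St(J)$ is the family of all homogeneous ideals $I\subset\mathcal P$ such that $\mathcal N(J)$ is a basis of $\mathcal P/I$ as a $k$-vector space. $J$-set: a set $G=\{f_\alpha=X^\alpha-\sum c_{\alpha\gamma}X^\gamma \mid X^\alpha\in B_J\}$ of homogeneous polynomials, one for each $X^\alpha\in B_J$, with $c_{\alpha\gamma}\in k$ and $X^\gamma\in\mathcal N(J)$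 of the same degree as $X^\alpha$. $S$-polynomial: $S(f_\alpha,f_{\alpha'})=X^\beta f_\alpha-X^{\beta'}f_{\alpha'}$ where $X^{\beta+\alpha}=X^{\beta'+\alpha'}=\mathrm{LCM}(X^\alpha,X^{\alpha'})$. For each $m$ let $W_m=\{X^\delta f_\alpha\mid X^{\delta+\alpha}\in J_m,\ X^\alpha\in B_J\}$. The head of $X^\delta f_\alpha$ is $X^{\delta+\alpha}$ and its tail is $X^{\delta+\alpha}-X^\delta f_\alpha$. For $X^\delta f_\alpha,X^{\delta'}f_{\alpha'}\in W_m$ put $X^\delta f_\alpha>X^{\delta'}f_{\alpha'}$ iff the first non-zero entry of $\delta'-\delta$ (entries indexed $0,1,\dots,n$ in this order) is positive. For a monomial $X^\beta\in J_m$, the subset $W_\beta\subseteq W_m$ of elements with head $X^\beta$ is finite and totally ordered by $<$. $V_m\subseteq W_m$ is the set consisting of the minimum of $W_\beta$ for each monomial $X^\beta\in J_m$. $G^{**}$-reduction: a step of $G^{**}$-reduction of a homogeneous polynomial $h$ of degree $m$ chooses a monomial $X^\beta\in J_m$ appearing in $h$ with nonzero coefficient and replaces it (keeping its coefficient) by the tail of the unique element of $V_m$ with head $X^\beta$. $h\stackrel{G^{**}}{\longrightarrow}_+h_0$ means that a finite (possibly empty) sequence of such steps leads from $h$ to $h_0$ and $h_0$ is a $k$-linear combination of monomials of $\mathcal N(J)$. *)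

theory Defs
  imports "HOL-Library.Poly_Mapping" "HOL-Computational_Algebra.Polynomial"
begin

text \<open>
  The polynomial ring \<open>k[X\<^sub>0,\<dots>,X\<^sub>n]\<close> is the type \<open>('x, 'k) mpoly\<close>, where \<open>'x\<close> is any finite
  linearly ordered type of variables, so that \<open>n + 1 = CARD('x)\<close>; its \<open>i\<close>-th smallest element
  (counting from \<open>0\<close>) plays the role of \<open>X\<^sub>i\<close>. A monomial \<open>X\<^sup>\<alpha>\<close> is represented by its exponent
  vector \<open>\<alpha>\<close>, and a product of monomials by the sum of the exponent vectors.
  The library orders \<open>\<le>\<close> and \<open><\<close> on poly-mappings are not used below.
\<close>

type_synonym 'x monomial = "'x \<Rightarrow>\<^sub>0 nat"
type_synonym ('x, 'k) mpoly = "'x monomial \<Rightarrow>\<^sub>0 'k"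

definition mon :: "'x monomial \<Rightarrow> ('x, 'k::comm_ring_1) mpoly" where
  "mon \<alpha> = Poly_Mapping.single \<alpha> 1"

definition const :: "'k::comm_ring_1 \<Rightarrow> ('x, 'k) mpoly" where
  "const c = Poly_Mapping.single 0 c"

definition deg :: "('x::finite) monomial \<Rightarrow> nat" where
  "deg \<alpha> = (\<Sum>i\<in>UNIV. Poly_Mapping.lookup \<alpha> i)"

definition mono_dvd :: "'x monomial \<Rightarrow> 'x monomial \<Rightarrow> bool" where
  "mono_dvd \<alpha> \<beta> \<longleftrightarrow> (\<forall>i. Poly_Mapping.lookup \<alpha> i \<le> Poly_Mapping.lookup \<beta> i)"

lift_definition mono_lcm :: "('x::finite) monomial \<Rightarrow> 'x monomial \<Rightarrow> 'x monomial"
  is "\<lambda>s t i. max (s i) (t i)"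
  by simp

definition homogeneous :: "nat \<Rightarrow> ('x::finite, 'k::comm_ring_1) mpoly \<Rightarrow> bool" where
  "homogeneous m p \<longleftrightarrow> (\<forall>\<alpha>\<in>Poly_Mapping.keys p. deg \<alpha> = m)"

text \<open>An ideal of a commutative ring is a submodule of the ring, regarded as a module over itself.\<close>

definition ideal_of :: "'a::comm_ring_1 set \<Rightarrow> 'a set" where
  "ideal_of = module.span (*)"

lemma module_times: "module ((*) :: 'a::comm_ring_1 \<Rightarrow> 'a \<Rightarrow> 'a)"
  by unfold_locales (simp_all add: algebra_simps)

lemma ideal_of_explicit: "ideal_of A = {(\<Sum>a\<in>F. r a * a) | F r. finite F \<and> F \<subseteq> A}"
  unfolding ideal_of_def by (rule module.span_explicit [OF module_times])

definition homogeneous_ideal :: "('x::finite, 'k::comm_ring_1) mpoly set \<Rightarrow> bool" where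
  "homogeneous_ideal I \<longleftrightarrow> (\<exists>H. (\<forall>h\<in>H. \<exists>m. homogeneous m h) \<and> I = ideal_of H)"

definition monomial_ideal :: "('x, 'k::comm_ring_1) mpoly set \<Rightarrow> bool" where
  "monomial_ideal J \<longleftrightarrow> (\<exists>A. J = ideal_of (mon ` A))"

definition min_gens :: "('x, 'k::comm_ring_1) mpoly set \<Rightarrow> 'x monomial set" where
  "min_gens J = {\<alpha>. mon \<alpha> \<in> J \<and> (\<forall>\<beta>. mon \<beta> \<in> J \<and> mono_dvd \<beta> \<alpha> \<longrightarrow> \<beta> = \<alpha>)}"

text \<open>
  These divisibility-minimal monomials generate \<open>J\<close>, and every set of monomials generating \<open>J\<close>
  contains them.
\<close>

lemma mono_dvd_add: "(\<beta> - \<alpha>) + \<alpha> = \<beta>" if "mono_dvd \<alpha> \<beta>"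
  using that by (intro poly_mapping_eqI) (simp add: mono_dvd_def lookup_add lookup_minus)

lemma deg_mono_dvd:
  assumes "mono_dvd \<alpha> \<beta>" "\<alpha> \<noteq> \<beta>"
  shows "deg \<alpha> < deg \<beta>"
proof -
  obtain i where "Poly_Mapping.lookup \<alpha> i \<noteq> Poly_Mapping.lookup \<beta> i"
    using assms(2) by (meson poly_mapping_eqI)
  then show ?thesis
    using assms(1) unfolding deg_def mono_dvd_def
    by (intro sum_strict_mono_ex1) (auto intro!: bexI[of _ i] simp: less_le)
qed

lemma ex_min_gens_dvd:
  fixes J :: "('x::finite, 'k::comm_ring_1) mpoly set"
  shows "mon \<alpha> \<in> J \<Longrightarrow> \<exists>\<beta>\<in>min_gens J. mono_dvd \<beta> \<alpha>"
proof (induction "deg \<alpha>" arbitrary: \<alpha> rule: less_induct)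
  case less
  show ?case
  proof (cases "\<alpha> \<in> min_gens J")
    case True
    then show ?thesis by (auto simp: mono_dvd_def)
  next
    case False
    then obtain \<gamma> where \<gamma>: "mon \<gamma> \<in> J" "mono_dvd \<gamma> \<alpha>" "\<gamma> \<noteq> \<alpha>"
      using less.prems by (auto simp: min_gens_def)
    then obtain \<beta> where "\<beta> \<in> min_gens J" "mono_dvd \<beta> \<gamma>"
      using less.hyps deg_mono_dvd by blast
    then show ?thesis
      using \<gamma>(2) by (meson mono_dvd_def order_trans)
  qed
qed

lemma mon_in_ideal_of:
  fixes A :: "'x monomial set"
  assumes "(mon \<alpha> :: ('x, 'k::comm_ring_1) mpoly) \<in> ideal_of (mon ` A)"
  shows "\<exists>\<beta>\<in>A. mono_dvd \<beta> \<alpha>"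
proof -
  have *: "\<exists>\<beta>\<in>A. mono_dvd \<beta> \<gamma>"
    if pI: "p \<in> ideal_of (mon ` A)" and \<gamma>: "\<gamma> \<in> Poly_Mapping.keys p" for p :: "('x, 'k) mpoly" and \<gamma>
  proof -
    obtain F r where F: "F \<subseteq> mon ` A" and p: "p = (\<Sum>a\<in>F. r a * a)"
      using pI unfolding ideal_of_explicit by blast
    have "Poly_Mapping.keys p \<subseteq> (\<Union>a\<in>F. Poly_Mapping.keys (r a * a))"
      unfolding p by (rule keys_sum)
    then obtain a where a: "a \<in> F" "\<gamma> \<in> Poly_Mapping.keys (r a * a)"
      using \<gamma> by blast
    obtain \<beta> where \<beta>: "\<beta> \<in> A" "a = mon \<beta>"
      using a(1) F by blast
    obtain \<delta> where "\<gamma> = \<delta> + \<beta>"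
      using a(2) \<beta>(2) keys_mult[of "r a" a] by (auto simp: mon_def)
    then show ?thesis
      using \<beta>(1) by (intro bexI[of _ \<beta>]) (auto simp: mono_dvd_def lookup_add)
  qed
  show ?thesis
    by (rule *[OF assms]) (simp add: mon_def)
qed

lemma ideal_of_min_gens:
  fixes J :: "('x::finite, 'k::comm_ring_1) mpoly set"
  assumes "monomial_ideal J"
  shows "ideal_of (mon ` min_gens J) = J"
proof -
  interpret module "(*) :: ('x, 'k) mpoly \<Rightarrow> _ \<Rightarrow> _" by (rule module_times)
  obtain A where A: "J = ideal_of (mon ` A)"
    using assms by (auto simp: monomial_ideal_def)
  have "mon ` min_gens J \<subseteq> span (mon ` A)"
    using A by (auto simp: min_gens_def ideal_of_def)
  moreover have "mon \<alpha> \<in> span (mon ` min_gens J)" if "\<alpha> \<in> A" for \<alpha>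
  proof -
    have "mon \<alpha> \<in> J" using that A by (simp add: ideal_of_def span_base)
    then obtain \<beta> where \<beta>: "\<beta> \<in> min_gens J" "mono_dvd \<beta> \<alpha>"
      using ex_min_gens_dvd by blast
    have "(mon \<alpha> :: ('x, 'k) mpoly) = mon (\<alpha> - \<beta>) * mon \<beta>"
      using mono_dvd_add[OF \<beta>(2)] by (simp add: mon_def mult_single)
    then show ?thesis
      using \<beta>(1) by (simp add: span_base span_scale)
  qed
  ultimately show ?thesis
    unfolding A ideal_of_def
    by (intro equalityI span_minimal subspace_span image_subsetI) (auto simp: A ideal_of_def)
qed

lemma min_gens_subset:
  fixes A :: "'x::finite monomial set"
  shows "min_gens (ideal_of (mon ` A) :: ('x, 'k::comm_ring_1) mpoly set) \<subseteq> A"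
proof
  interpret module "(*) :: ('x, 'k) mpoly \<Rightarrow> _ \<Rightarrow> _" by (rule module_times)
  fix \<alpha>
  assume \<alpha>: "\<alpha> \<in> min_gens (ideal_of (mon ` A) :: ('x, 'k) mpoly set)"
  then have "(mon \<alpha> :: ('x, 'k) mpoly) \<in> ideal_of (mon ` A)"
    by (simp add: min_gens_def)
  then obtain \<beta> where \<beta>: "\<beta> \<in> A" "mono_dvd \<beta> \<alpha>"
    using mon_in_ideal_of by blast
  have "(mon \<beta> :: ('x, 'k) mpoly) \<in> ideal_of (mon ` A)"
    using \<beta>(1) by (simp add: ideal_of_def span_base)
  then have "\<beta> = \<alpha>"
    using \<alpha> \<beta>(2) by (simp add: min_gens_def)
  then show "\<alpha> \<in> A" using \<beta>(1) by simp
qed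

definition sous_escalier :: "('x, 'k::comm_ring_1) mpoly set \<Rightarrow> 'x monomial set" where
  "sous_escalier J = {\<alpha>. mon \<alpha> \<notin> J}"

definition up_move :: "('x::linorder) monomial \<Rightarrow> 'x monomial \<Rightarrow> bool" where
  "up_move \<alpha> \<beta> \<longleftrightarrow> (\<exists>\<delta> i j. i < j \<and>
     \<alpha> = \<delta> + Poly_Mapping.single i 1 \<and> \<beta> = \<delta> + Poly_Mapping.single j 1)"

definition borel_less :: "('x::linorder) monomial \<Rightarrow> 'x monomial \<Rightarrow> bool" where
  "borel_less = up_move\<^sup>+\<^sup>+"

definition strongly_stable :: "('x::linorder, 'k::comm_ring_1) mpoly set \<Rightarrow> bool" where
  "strongly_stable J \<longleftrightarrow> monomial_ideal J \<and>
     (\<forall>\<alpha> \<beta>. mon \<beta> \<in> J \<and> borel_less \<beta> \<alpha> \<longrightarrow> mon \<alpha> \<in> J)"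

text \<open>
  The classes modulo \<open>I\<close> of the monomials in \<open>N\<close> form a basis of the quotient vector space: the
  class of a linear combination is the linear combination of the classes, and a class vanishes
  in the quotient iff its representatives lie in \<open>I\<close>. The two conjuncts say that the classes are
  linearly independent and that they span.
\<close>

definition quotient_basis ::
    "'x monomial set \<Rightarrow> ('x, 'k::comm_ring_1) mpoly set \<Rightarrow> bool" where
  "quotient_basis N I \<longleftrightarrow>
     (\<forall>F c. finite F \<and> F \<subseteq> N \<and> (\<Sum>\<gamma>\<in>F. const (c \<gamma>) * mon \<gamma>) \<in> I \<longrightarrow> (\<forall>\<gamma>\<in>F. c \<gamma> = 0)) \<and>
     (\<forall>p. \<exists>F c. finite F \<and> F \<subseteq> N \<and> p - (\<Sum>\<gamma>\<in>F. const (c \<gamma>) * mon \<gamma>) \<in> I)"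

definition BSt :: "('x::finite, 'k::comm_ring_1) mpoly set \<Rightarrow> ('x, 'k) mpoly set set" where
  "BSt J = {I. homogeneous_ideal I \<and> quotient_basis (sous_escalier J) I}"

text \<open>
  A \<open>J\<close>-set is a family \<open>f\<close> indexed by \<open>min_gens J\<close>; the values of \<open>f\<close> elsewhere are never used.
\<close>

definition J_set ::
    "('x::finite, 'k::comm_ring_1) mpoly set \<Rightarrow> ('x monomial \<Rightarrow> ('x, 'k) mpoly) \<Rightarrow> bool" where
  "J_set J f \<longleftrightarrow> (\<forall>\<alpha>\<in>min_gens J. \<forall>\<gamma>\<in>Poly_Mapping.keys (mon \<alpha> - f \<alpha>).
     \<gamma> \<in> sous_escalier J \<and> deg \<gamma> = deg \<alpha>)"

text \<open>The differences below are exact, because \<open>\<alpha>\<close> and \<open>\<alpha>'\<close> divide their least common multiple.\<close>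

definition S_poly ::
    "('x::finite monomial \<Rightarrow> ('x, 'k::comm_ring_1) mpoly) \<Rightarrow> 'x monomial \<Rightarrow> 'x monomial
      \<Rightarrow> ('x, 'k) mpoly" where
  "S_poly f \<alpha> \<alpha>' =
     mon (mono_lcm \<alpha> \<alpha>' - \<alpha>) * f \<alpha> - mon (mono_lcm \<alpha> \<alpha>' - \<alpha>') * f \<alpha>'"

text \<open>
  The element \<open>X\<^sup>\<delta> f\<^sub>\<alpha>\<close> of \<open>W\<^sub>m\<close> is encoded by the pair \<open>(\<delta>, \<alpha>)\<close>, since its head and its place in
  the order depend on the pair, and distinct pairs may give the same polynomial.
\<close>

definition W :: "('x::finite, 'k::comm_ring_1) mpoly set \<Rightarrow> nat \<Rightarrow> ('x monomial \<times> 'x monomial) set"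
  where "W J m = {(\<delta>, \<alpha>). \<alpha> \<in> min_gens J \<and> mon (\<delta> + \<alpha>) \<in> J \<and> deg (\<delta> + \<alpha>) = m}"

fun head :: "'x monomial \<times> 'x monomial \<Rightarrow> 'x monomial" where
  "head (\<delta>, \<alpha>) = \<delta> + \<alpha>"

fun tail :: "('x monomial \<Rightarrow> ('x, 'k::comm_ring_1) mpoly) \<Rightarrow> 'x monomial \<times> 'x monomial
    \<Rightarrow> ('x, 'k) mpoly" where
  "tail f (\<delta>, \<alpha>) = mon (\<delta> + \<alpha>) - mon \<delta> * f \<alpha>"

text \<open>\<open>W_greater (\<delta>, \<alpha>) (\<delta>', \<alpha>')\<close>: the first non-zero entry of \<open>\<delta>' - \<delta>\<close> is positive.\<close>

fun W_greater :: "('x::linorder) monomial \<times> 'x monomial \<Rightarrow> 'x monomial \<times> 'x monomial \<Rightarrow> bool" where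
  "W_greater (\<delta>, \<alpha>) (\<delta>', \<alpha>') \<longleftrightarrow>
     (\<exists>i. Poly_Mapping.lookup \<delta> i < Poly_Mapping.lookup \<delta>' i \<and>
          (\<forall>j<i. Poly_Mapping.lookup \<delta> j = Poly_Mapping.lookup \<delta>' j))"

definition V :: "('x::{finite,linorder}, 'k::comm_ring_1) mpoly set \<Rightarrow> nat
    \<Rightarrow> ('x monomial \<times> 'x monomial) set" where
  "V J m = {w \<in> W J m. \<forall>w'\<in>W J m. head w' = head w \<and> w' \<noteq> w \<longrightarrow> W_greater w' w}"

definition Gss_step :: "('x::{finite,linorder}, 'k::comm_ring_1) mpoly set
    \<Rightarrow> ('x monomial \<Rightarrow> ('x, 'k) mpoly) \<Rightarrow> ('x, 'k) mpoly \<Rightarrow> ('x, 'k) mpoly \<Rightarrow> bool" where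
  "Gss_step J f h h' \<longleftrightarrow> (\<exists>m \<beta> w. homogeneous m h \<and>
     \<beta> \<in> Poly_Mapping.keys h \<and> mon \<beta> \<in> J \<and> deg \<beta> = m \<and>
     w \<in> V J m \<and> head w = \<beta> \<and>
     h' = h - const (Poly_Mapping.lookup h \<beta>) * mon \<beta>
            + const (Poly_Mapping.lookup h \<beta>) * tail f w)"

definition Gss_reduces :: "('x::{finite,linorder}, 'k::comm_ring_1) mpoly set
    \<Rightarrow> ('x monomial \<Rightarrow> ('x, 'k) mpoly) \<Rightarrow> ('x, 'k) mpoly \<Rightarrow> ('x, 'k) mpoly \<Rightarrow> bool" where
  "Gss_reduces J f h h\<^sub>0 \<longleftrightarrow>
     (Gss_step J f)\<^sup>*\<^sup>* h h\<^sub>0 \<and> Poly_Mapping.keys h\<^sub>0 \<subseteq> sous_escalier J"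

end

theory Submission
  imports Defs "HOL-Library.FuncSet"
begin

text \<open>
  For a strongly stable \<open>J\<close>, the elements of \<open>V\<^sub>m\<close> are the \<open>X\<^sup>\<delta> f\<^sub>\<alpha>\<close> for which every variable of \<open>X\<^sup>\<delta>\<close>
  is at most every variable of \<open>X\<^sup>\<alpha>\<close> (the Eliahou--Kervaire decomposition of the head). Compare
  multipliers \<open>\<delta>\<close> lexicographically, starting from the largest variable. If \<open>X\<^sup>\<delta> X\<^sup>\<gamma>\<close> with
  \<open>X\<^sup>\<gamma> \<in> N(J)\<close> lies in \<open>J\<close>, its decomposition has a multiplier smaller than \<open>\<delta>\<close>. Hence reduction
  terminates, and the elements of \<open>V\<^sub>m\<close> are linearly independent modulo \<open>N(J)\<close>. If the S-polynomials
  reduce to zero, induction on \<open>\<delta>\<close> shows that every \<open>X\<^sup>\<delta> f\<^sub>\<alpha>\<close> is a linear combination of elements of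
  \<open>V\<^sub>m\<close>, so that \<open>I\<close> meets the span of \<open>N(J)\<close> only in \<open>0\<close>.
\<close>

section \<open>Monomials and polynomials\<close>

lemma lookup_const_mult: "Poly_Mapping.lookup (const c * p) \<beta> = c * Poly_Mapping.lookup p \<beta>"
  unfolding const_def mult_map_scale_conv_mult[symmetric]
  by (simp add: Poly_Mapping.map.rep_eq when_def)

lemma const_mult: "const (a * b) = const a * const b"
  by (simp add: const_def mult_single)

lemma const_add: "const (a + b) = const a + const b"
  by (simp add: const_def single_add)

lemma const_1 [simp]: "const 1 = 1"
  by (simp add: const_def)

lemma mon_add: "mon (\<alpha> + \<beta>) = mon \<alpha> * mon \<beta>"
  by (simp add: mon_def mult_single)

lemma keys_mon [simp]: "Poly_Mapping.keys (mon \<alpha> :: ('x, 'k::comm_ring_1) mpoly) = {\<alpha>}"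
  by (simp add: mon_def)

lemma keys_const_mult: "Poly_Mapping.keys (const c * p) \<subseteq> Poly_Mapping.keys p"
  by (auto simp: in_keys_iff lookup_const_mult)

lemma keys_mon_mult: "Poly_Mapping.keys (mon \<delta> * p) \<subseteq> (+) \<delta> ` Poly_Mapping.keys p"
  using keys_mult[of "mon \<delta>" p] by auto

lemma lookup_sum_const_mon:
  assumes "finite F"
  shows "Poly_Mapping.lookup (\<Sum>\<gamma>\<in>F. const (c \<gamma>) * mon \<gamma>) \<beta> = (if \<beta> \<in> F then c \<beta> else 0)"
proof -
  have "Poly_Mapping.lookup (\<Sum>\<gamma>\<in>F. const (c \<gamma>) * mon \<gamma>) \<beta> = (\<Sum>\<gamma>\<in>F. if \<beta> = \<gamma> then c \<gamma> else 0)"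
    by (auto simp: lookup_sum lookup_const_mult mon_def lookup_single when_def intro!: sum.cong)
  then show ?thesis using assms by simp
qed

lemma poly_eq_sum_monomials:
  "p = (\<Sum>\<gamma>\<in>Poly_Mapping.keys p. const (Poly_Mapping.lookup p \<gamma>) * mon \<gamma>)"
  by (rule poly_mapping_eqI) (simp add: lookup_sum_const_mon in_keys_iff)

lemma deg_add: "deg (\<alpha> + \<beta>) = deg \<alpha> + deg \<beta>"
  by (simp add: deg_def lookup_add sum.distrib)

text \<open>Each exponent is at most \<open>m\<close>, so exponent vectors embed into a finite
  function space. Termination and the induction on multipliers rest on this finiteness.\<close>

lemma finite_deg_le: "finite {\<alpha> :: 'x::finite monomial. deg \<alpha> \<le> m}"
proof -
  have "Poly_Mapping.lookup \<alpha> i \<le> m" if "deg \<alpha> \<le> m" for \<alpha> :: "'x monomial" and i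
    using that member_le_sum[of i UNIV "Poly_Mapping.lookup \<alpha>"] by (simp add: deg_def)
  then have "Poly_Mapping.lookup ` {\<alpha> :: 'x monomial. deg \<alpha> \<le> m} \<subseteq> PiE UNIV (\<lambda>_. {..m})"
    by (auto simp: PiE_iff)
  then have "finite (Poly_Mapping.lookup ` {\<alpha> :: 'x monomial. deg \<alpha> \<le> m})"
    by (rule finite_subset) (intro finite_PiE finite_UNIV finite_atMost)
  then show ?thesis
    by (rule finite_imageD) (simp add: inj_on_def)
qed

lemma mono_dvd_lcm: "mono_dvd \<alpha> (mono_lcm \<alpha> \<beta>)" "mono_dvd \<beta> (mono_lcm \<alpha> \<beta>)"
  by (simp_all add: mono_dvd_def mono_lcm.rep_eq)

lemma mono_lcm_least: "mono_dvd \<alpha> \<gamma> \<Longrightarrow> mono_dvd \<beta> \<gamma> \<Longrightarrow> mono_dvd (mono_lcm \<alpha> \<beta>) \<gamma>"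
  by (simp add: mono_dvd_def mono_lcm.rep_eq)

lemma homogeneous_diff: "homogeneous m p \<Longrightarrow> homogeneous m q \<Longrightarrow> homogeneous m (p - q)"
  using keys_diff[of p q] by (auto simp: homogeneous_def)

lemma homogeneous_const_mult: "homogeneous m p \<Longrightarrow> homogeneous m (const c * p)"
  using keys_const_mult[of c p] by (auto simp: homogeneous_def)

lemma homogeneous_mon: "homogeneous (deg \<delta>) (mon \<delta> :: ('x::finite, 'k::comm_ring_1) mpoly)"
  by (simp add: homogeneous_def)

text \<open>Polynomials as a module over the coefficient ring, for linear combinations with scalar
  coefficients. Ideals are spans over the polynomial ring itself.\<close>

interpretation kspan: module "\<lambda>(c::'k::comm_ring_1) (p::('x, 'k) mpoly). const c * p"
  by unfold_locales (simp_all add: algebra_simps const_add const_mult)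

text \<open>A polynomial is the combination of its own monomials, so a pair \<open>F\<close>,
  \<open>c\<close> over \<open>N\<close> amounts to a polynomial with support in \<open>N\<close>.
  This form fits the results of reductions.\<close>

lemma quotient_basis_iff:
  fixes N :: "'x monomial set" and I :: "('x, 'k::comm_ring_1) mpoly set"
  shows "quotient_basis N I \<longleftrightarrow>
    (\<forall>q\<in>I. Poly_Mapping.keys q \<subseteq> N \<longrightarrow> q = 0) \<and> (\<forall>p. \<exists>q. Poly_Mapping.keys q \<subseteq> N \<and> p - q \<in> I)"
proof -
  have keys: "Poly_Mapping.keys (\<Sum>\<gamma>\<in>F. const (c \<gamma>) * mon \<gamma> :: ('x, 'k) mpoly) \<subseteq> F"
    if "finite F" for F c
    using that by (auto simp: in_keys_iff lookup_sum_const_mon split: if_splits)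
  have 1: "(\<forall>F c. finite F \<and> F \<subseteq> N \<and> (\<Sum>\<gamma>\<in>F. const (c \<gamma>) * mon \<gamma>) \<in> I \<longrightarrow> (\<forall>\<gamma>\<in>F. c \<gamma> = 0))
      \<longleftrightarrow> (\<forall>q\<in>I. Poly_Mapping.keys q \<subseteq> N \<longrightarrow> q = 0)" (is "?L \<longleftrightarrow> ?R")
  proof
    assume L: ?L
    show ?R
    proof (intro ballI impI)
      fix q assume q: "q \<in> I" "Poly_Mapping.keys q \<subseteq> N"
      have "\<forall>\<gamma>\<in>Poly_Mapping.keys q. Poly_Mapping.lookup q \<gamma> = 0"
        using L[rule_format, of "Poly_Mapping.keys q" "Poly_Mapping.lookup q"] q
        by (simp flip: poly_eq_sum_monomials)
      then show "q = 0"
        by (metis in_keys_iff lookup_zero poly_mapping_eqI)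
    qed
  next
    assume R: ?R
    show ?L
    proof (intro allI impI ballI, elim conjE)
      fix F c \<gamma> assume *: "finite F" "F \<subseteq> N" "(\<Sum>\<gamma>\<in>F. const (c \<gamma>) * mon \<gamma>) \<in> I" "\<gamma> \<in> F"
      have "(\<Sum>\<gamma>\<in>F. const (c \<gamma>) * mon \<gamma>) = (0 :: ('x, 'k) mpoly)"
        using R * keys by blast
      then show "c \<gamma> = 0"
        using lookup_sum_const_mon[OF *(1), of c \<gamma>] *(4) by simp
    qed
  qed
  have 2: "(\<exists>F c. finite F \<and> F \<subseteq> N \<and> p - (\<Sum>\<gamma>\<in>F. const (c \<gamma>) * mon \<gamma>) \<in> I)
      \<longleftrightarrow> (\<exists>q. Poly_Mapping.keys q \<subseteq> N \<and> p - q \<in> I)" (is "?L \<longleftrightarrow> ?R") for p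
  proof
    assume ?L then show ?R using keys by (meson order_trans)
  next
    assume ?R
    then obtain q where "Poly_Mapping.keys q \<subseteq> N" "p - q \<in> I" by blast
    then show ?L
      by (intro exI[of _ "Poly_Mapping.keys q"] exI[of _ "Poly_Mapping.lookup q"])
        (simp flip: poly_eq_sum_monomials)
  qed
  show ?thesis unfolding quotient_basis_def 1 2 ..
qed

section \<open>Star decompositions\<close>

text \<open>Lexicographic order whose most significant variable is the largest one;
  \<open>W_greater\<close> scans from the smallest.\<close>

definition lex_less :: "('x::linorder) monomial \<Rightarrow> 'x monomial \<Rightarrow> bool" where
  "lex_less \<delta> \<epsilon> \<longleftrightarrow> (\<exists>i. Poly_Mapping.lookup \<delta> i < Poly_Mapping.lookup \<epsilon> i \<and>
     (\<forall>j>i. Poly_Mapping.lookup \<delta> j = Poly_Mapping.lookup \<epsilon> j))"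

lemma lex_less_irrefl: "\<not> lex_less \<delta> \<delta>"
  by (simp add: lex_less_def)

lemma lex_less_trans: "lex_less \<delta> \<epsilon> \<Longrightarrow> lex_less \<epsilon> \<zeta> \<Longrightarrow> lex_less \<delta> \<zeta>"
  unfolding lex_less_def
proof (elim exE conjE)
  fix i j
  assume *: "Poly_Mapping.lookup \<delta> i < Poly_Mapping.lookup \<epsilon> i"
    "\<forall>j>i. Poly_Mapping.lookup \<delta> j = Poly_Mapping.lookup \<epsilon> j"
    "Poly_Mapping.lookup \<epsilon> j < Poly_Mapping.lookup \<zeta> j"
    "\<forall>i>j. Poly_Mapping.lookup \<epsilon> i = Poly_Mapping.lookup \<zeta> i"
  show "\<exists>i. Poly_Mapping.lookup \<delta> i < Poly_Mapping.lookup \<zeta> i \<and>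
     (\<forall>j>i. Poly_Mapping.lookup \<delta> j = Poly_Mapping.lookup \<zeta> j)"
    \<comment> \<open>Beyond the larger pivot all three vectors agree, and at that pivot at least
      one of the two comparisons is strict.\<close>
    using * by (intro exI[of _ "max i j"]) (cases i j rule: linorder_cases; auto simp: max_def)
qed

lemma lex_less_add_iff: "lex_less (\<eta> + \<delta>) (\<eta> + \<epsilon>) \<longleftrightarrow> lex_less \<delta> \<epsilon>"
  by (simp add: lex_less_def lookup_add)

lemma ex_top_diff:
  fixes \<delta> \<epsilon> :: "'x::{finite,linorder} monomial"
  assumes "\<delta> \<noteq> \<epsilon>"
  obtains i where "Poly_Mapping.lookup \<delta> i \<noteq> Poly_Mapping.lookup \<epsilon> i"
    "\<And>j. j > i \<Longrightarrow> Poly_Mapping.lookup \<delta> j = Poly_Mapping.lookup \<epsilon> j"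
proof -
  let ?A = "{i. Poly_Mapping.lookup \<delta> i \<noteq> Poly_Mapping.lookup \<epsilon> i}"
  have "?A \<noteq> {}" using assms by (auto intro: poly_mapping_eqI)
  then have "Max ?A \<in> ?A" by (intro Max_in) simp
  moreover have "j \<notin> ?A" if "j > Max ?A" for j
    using that Max_ge[of ?A j] by (meson finite linorder_not_less)
  ultimately show thesis using that[of "Max ?A"] by blast
qed

lemma ex_bot_diff:
  fixes \<delta> \<epsilon> :: "'x::{finite,linorder} monomial"
  assumes "\<delta> \<noteq> \<epsilon>"
  obtains i where "Poly_Mapping.lookup \<delta> i \<noteq> Poly_Mapping.lookup \<epsilon> i"
    "\<And>j. j < i \<Longrightarrow> Poly_Mapping.lookup \<delta> j = Poly_Mapping.lookup \<epsilon> j"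
proof -
  let ?A = "{i. Poly_Mapping.lookup \<delta> i \<noteq> Poly_Mapping.lookup \<epsilon> i}"
  have "?A \<noteq> {}" using assms by (auto intro: poly_mapping_eqI)
  then have "Min ?A \<in> ?A" by (intro Min_in) simp
  moreover have "j \<notin> ?A" if "j < Min ?A" for j
    using that Min_le[of ?A j] by (meson finite linorder_not_less)
  ultimately show thesis using that[of "Min ?A"] by blast
qed

definition separated :: "('x::linorder) monomial \<Rightarrow> 'x monomial \<Rightarrow> bool" where
  "separated \<delta> \<alpha> \<longleftrightarrow>
     (\<forall>i j. Poly_Mapping.lookup \<delta> i \<noteq> 0 \<longrightarrow> Poly_Mapping.lookup \<alpha> j \<noteq> 0 \<longrightarrow> i \<le> j)"

text \<open>Consider the largest variable \<open>i\<close> where the multipliers differ. If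
  \<epsilon> has the larger exponent there, separation keeps \<alpha> free of variables below
  \<open>i\<close>, and from \<open>i\<close> upwards equality of the products bounds \<alpha> by
  \<gamma>. For \<gamma> outside \<open>J\<close> and \<alpha> a generator, divisibility is
  impossible, so the multiplier drops.\<close>

lemma separated_lex_less_or_dvd:
  fixes \<delta> \<gamma> \<epsilon> \<alpha> :: "'x::{finite,linorder} monomial"
  assumes "separated \<epsilon> \<alpha>" "\<epsilon> + \<alpha> = \<delta> + \<gamma>"
  shows "lex_less \<epsilon> \<delta> \<or> mono_dvd \<alpha> \<gamma>"
proof (cases "\<epsilon> = \<delta>")
  case True
  then show ?thesis using assms(2) by (simp add: mono_dvd_def)
next
  case False
  have eq: "Poly_Mapping.lookup \<epsilon> k + Poly_Mapping.lookup \<alpha> k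
      = Poly_Mapping.lookup \<delta> k + Poly_Mapping.lookup \<gamma> k" for k
    using assms(2) by (metis lookup_add)
  obtain i where i: "Poly_Mapping.lookup \<epsilon> i \<noteq> Poly_Mapping.lookup \<delta> i"
    "\<And>j. j > i \<Longrightarrow> Poly_Mapping.lookup \<epsilon> j = Poly_Mapping.lookup \<delta> j"
    using ex_top_diff[OF False] by blast
  show ?thesis
  proof (cases "Poly_Mapping.lookup \<epsilon> i < Poly_Mapping.lookup \<delta> i")
    case True
    then show ?thesis using i(2) by (auto simp: lex_less_def)
  next
    case False
    then have gt: "Poly_Mapping.lookup \<epsilon> i > Poly_Mapping.lookup \<delta> i" using i(1) by simp
    have "Poly_Mapping.lookup \<alpha> k \<le> Poly_Mapping.lookup \<gamma> k" for k
    proof (cases k i rule: linorder_cases)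
      case less
      then have "Poly_Mapping.lookup \<alpha> k = 0"
        using assms(1) gt unfolding separated_def by (metis leD not_less_zero)
      then show ?thesis by simp
    next
      case equal
      then show ?thesis using eq[of i] gt by simp
    next
      case greater
      then show ?thesis using eq[of k] i(2)[of k] by simp
    qed
    then show ?thesis by (simp add: mono_dvd_def)
  qed
qed

section \<open>Eliahou-Kervaire decompositions and the sets \<open>V J m\<close>\<close>

lemma min_gens_dvd_eq: "\<alpha> \<in> min_gens J \<Longrightarrow> \<beta> \<in> min_gens J \<Longrightarrow> mono_dvd \<alpha> \<beta> \<Longrightarrow> \<alpha> = \<beta>"
  by (simp add: min_gens_def)

text \<open>The union of all \<open>V J m\<close> when \<open>J\<close> is strongly stable,
  described without reference to a degree or to \<open>W_greater\<close>.\<close>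

definition star_pairs ::
    "('x::{finite,linorder}, 'k::comm_ring_1) mpoly set \<Rightarrow> ('x monomial \<times> 'x monomial) set" where
  "star_pairs J = {(\<delta>, \<alpha>). \<alpha> \<in> min_gens J \<and> separated \<delta> \<alpha>}"

text \<open>Comparing the two decompositions both ways, different generators would make each
  multiplier smaller than the other.\<close>

lemma star_pairs_unique:
  assumes "(\<delta>, \<alpha>) \<in> star_pairs J" "(\<epsilon>, \<beta>) \<in> star_pairs J" "\<delta> + \<alpha> = \<epsilon> + \<beta>"
  shows "(\<delta>, \<alpha>) = (\<epsilon>, \<beta>)"
proof -
  have "lex_less \<delta> \<epsilon> \<or> \<alpha> = \<beta>" "lex_less \<epsilon> \<delta> \<or> \<alpha> = \<beta>"
    using assms separated_lex_less_or_dvd[of \<delta> \<alpha> \<epsilon> \<beta>] separated_lex_less_or_dvd[of \<epsilon> \<beta> \<delta> \<alpha>]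
      min_gens_dvd_eq by (auto simp: star_pairs_def)
  then have "\<alpha> = \<beta>" using lex_less_trans lex_less_irrefl by blast
  then show ?thesis using assms(3) by simp
qed

lemma ideal_mult: "p \<in> J \<Longrightarrow> r * p \<in> J" if "J = ideal_of A" for J :: "'a::comm_ring_1 set"
  using that module.span_scale[OF module_times] by (auto simp: ideal_of_def)

lemma mon_mono_dvd:
  assumes "monomial_ideal J" "mon \<alpha> \<in> J" "mono_dvd \<alpha> \<beta>"
  shows "mon \<beta> \<in> J"
proof -
  obtain A where "J = ideal_of (mon ` A)" using assms(1) by (auto simp: monomial_ideal_def)
  then have "mon (\<beta> - \<alpha>) * mon \<alpha> \<in> J" using ideal_mult assms(2) by blast
  then show ?thesis using mono_dvd_add[OF assms(3)] by (simp flip: mon_add)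
qed

text \<open>By strong stability, the smallest variable of a non-minimal monomial of \<open>J\<close> can be
  cancelled without leaving \<open>J\<close>.\<close>

lemma ex_star_pair:
  fixes J :: "('x::{finite,linorder}, 'k::comm_ring_1) mpoly set"
  assumes "strongly_stable J"
  shows "mon \<beta> \<in> J \<Longrightarrow> \<exists>\<delta> \<alpha>. (\<delta>, \<alpha>) \<in> star_pairs J \<and> \<beta> = \<delta> + \<alpha>"
proof (induction "deg \<beta>" arbitrary: \<beta> rule: less_induct)
  case less
  have mi: "monomial_ideal J" using assms by (simp add: strongly_stable_def)
  show ?case
  proof (cases "\<beta> \<in> min_gens J")
    case True
    then show ?thesis
      by (intro exI[of _ 0] exI[of _ \<beta>]) (simp add: star_pairs_def separated_def)
  next
    case False
    then obtain \<gamma> where \<gamma>: "mon \<gamma> \<in> J" "mono_dvd \<gamma> \<beta>" "\<gamma> \<noteq> \<beta>"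
      using less.prems by (auto simp: min_gens_def)
    then obtain j where j: "Poly_Mapping.lookup \<gamma> j < Poly_Mapping.lookup \<beta> j"
      by (metis mono_dvd_def order_le_less poly_mapping_eqI)
    let ?A = "{i. Poly_Mapping.lookup \<beta> i \<noteq> 0}"
    define i where "i = Min ?A"
    have "?A \<noteq> {}" using j by (auto intro!: exI[of _ j])
    then have "i \<in> ?A" unfolding i_def by (intro Min_in) auto
    then have i: "Poly_Mapping.lookup \<beta> i \<noteq> 0" by simp
    have i_le: "i \<le> k" if "Poly_Mapping.lookup \<beta> k \<noteq> 0" for k
      unfolding i_def using that by (intro Min_le) auto
    define \<beta>' where "\<beta>' = \<beta> - Poly_Mapping.single i 1"
    have \<beta>: "\<beta> = \<beta>' + Poly_Mapping.single i 1"
      unfolding \<beta>'_def using i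
      by (intro poly_mapping_eqI) (auto simp: lookup_add lookup_minus lookup_single when_def)
    define \<beta>\<^sub>j where "\<beta>\<^sub>j = \<beta> - Poly_Mapping.single j 1"
    have "mono_dvd \<gamma> \<beta>\<^sub>j"
      using \<gamma>(2) j by (auto simp: \<beta>\<^sub>j_def mono_dvd_def lookup_minus lookup_single when_def)
    then have \<beta>\<^sub>j: "mon \<beta>\<^sub>j \<in> J" using mi \<gamma>(1) mon_mono_dvd by blast
    \<comment> \<open>The monomial \<open>\<beta>\<^sub>j\<close> is still divisible by \<gamma>. If
      \<open>j\<close> is not the smallest variable \<open>i\<close>, trading one \<open>i\<close>
      for a \<open>j\<close> in it is an up move that yields \<open>\<beta>'\<close>.\<close>
    have "mon \<beta>' \<in> J"
    proof (cases "i = j")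
      case True
      then show ?thesis using \<beta>\<^sub>j by (simp add: \<beta>'_def \<beta>\<^sub>j_def)
    next
      case False
      then have "i < j" using i_le[of j] j by auto
      have "up_move \<beta>\<^sub>j \<beta>'"
        unfolding up_move_def
      proof (intro exI conjI)
        show "\<beta>\<^sub>j = (\<beta> - Poly_Mapping.single i 1 - Poly_Mapping.single j 1) + Poly_Mapping.single i 1"
          using \<open>i \<noteq> j\<close> i by (intro poly_mapping_eqI)
            (auto simp: \<beta>\<^sub>j_def lookup_add lookup_minus lookup_single when_def)
        show "\<beta>' = (\<beta> - Poly_Mapping.single i 1 - Poly_Mapping.single j 1) + Poly_Mapping.single j 1"
          using \<open>i \<noteq> j\<close> j by (intro poly_mapping_eqI)
            (auto simp: \<beta>'_def lookup_add lookup_minus lookup_single when_def)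
      qed fact
      then have "borel_less \<beta>\<^sub>j \<beta>'" by (auto simp: borel_less_def)
      then show ?thesis using assms \<beta>\<^sub>j by (auto simp: strongly_stable_def)
    qed
    moreover have "deg \<beta>' < deg \<beta>"
      by (subst \<beta>) (simp only: deg_add, simp add: deg_def lookup_single when_def)
    ultimately obtain \<delta> \<alpha> where *: "(\<delta>, \<alpha>) \<in> star_pairs J" "\<beta>' = \<delta> + \<alpha>"
      using less.hyps by blast
    \<comment> \<open>Separation survives because \<open>i\<close> is at most every variable of
      \<beta>, hence of \<alpha>.\<close>
    have "(Poly_Mapping.single i 1 + \<delta>, \<alpha>) \<in> star_pairs J"
      using *(1) i_le \<beta> *(2)
      by (auto simp: star_pairs_def separated_def lookup_add lookup_single when_def split: if_splits)
    moreover have "\<beta> = Poly_Mapping.single i 1 + \<delta> + \<alpha>"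
      using \<beta> *(2) by (simp add: add_ac)
    ultimately show ?thesis by blast
  qed
qed

text \<open>Suppose \<delta> is first exceeded by \<epsilon> at \<open>i\<close>. Then \<alpha>
  contains \<open>i\<close>, so \<delta> has no variable above \<open>i\<close>, and comparing
  exponents shows that \<beta> divides \<alpha>. Minimality makes the pairs equal. The other claim
  follows because different multipliers are comparable.\<close>

lemma star_pair_W_greater:
  assumes star: "(\<delta>, \<alpha>) \<in> star_pairs J" and "\<beta> \<in> min_gens J" "\<delta> + \<alpha> = \<epsilon> + \<beta>" "(\<epsilon>, \<beta>) \<noteq> (\<delta>, \<alpha>)"
  shows "W_greater (\<epsilon>, \<beta>) (\<delta>, \<alpha>)" "\<not> W_greater (\<delta>, \<alpha>) (\<epsilon>, \<beta>)"
proof -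
  have eq: "Poly_Mapping.lookup \<delta> k + Poly_Mapping.lookup \<alpha> k
      = Poly_Mapping.lookup \<epsilon> k + Poly_Mapping.lookup \<beta> k" for k
    using assms(3) by (metis lookup_add)
  show not: "\<not> W_greater (\<delta>, \<alpha>) (\<epsilon>, \<beta>)"
  proof
    assume "W_greater (\<delta>, \<alpha>) (\<epsilon>, \<beta>)"
    then obtain i where i: "Poly_Mapping.lookup \<delta> i < Poly_Mapping.lookup \<epsilon> i"
      "\<And>j. j < i \<Longrightarrow> Poly_Mapping.lookup \<delta> j = Poly_Mapping.lookup \<epsilon> j" by auto
    have "Poly_Mapping.lookup \<beta> k \<le> Poly_Mapping.lookup \<alpha> k" for k
    proof (cases k i rule: linorder_cases)
      case less
      then show ?thesis using eq[of k] i(2)[of k] by simp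
    next
      case equal
      then show ?thesis using eq[of i] i(1) by simp
    next
      case greater
      have "Poly_Mapping.lookup \<alpha> i \<noteq> 0" using eq[of i] i(1) by simp
      then have "Poly_Mapping.lookup \<delta> k = 0"
        using star greater unfolding star_pairs_def separated_def by (auto dest: leD)
      then show ?thesis using eq[of k] by simp
    qed
    then have "\<beta> = \<alpha>"
      using assms(1,2) min_gens_dvd_eq by (auto simp: star_pairs_def mono_dvd_def)
    then show False using assms(3,4) by simp
  qed
  have "\<delta> \<noteq> \<epsilon>" using assms(3,4) by auto
  then obtain i where "Poly_Mapping.lookup \<delta> i \<noteq> Poly_Mapping.lookup \<epsilon> i"
    "\<And>j. j < i \<Longrightarrow> Poly_Mapping.lookup \<delta> j = Poly_Mapping.lookup \<epsilon> j"
    using ex_bot_diff by blast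
  then show "W_greater (\<epsilon>, \<beta>) (\<delta>, \<alpha>)"
    using not by (auto simp: not_less) (metis le_neq_implies_less)
qed

text \<open>A star pair lies below every other pair with its head. Conversely, a minimal pair must
  be the star pair that exists for its head, since that one cannot be greater.\<close>

lemma V_eq_star_pairs:
  fixes J :: "('x::{finite,linorder}, 'k::comm_ring_1) mpoly set"
  assumes "strongly_stable J"
  shows "V J m = {(\<delta>, \<alpha>) \<in> star_pairs J. deg (\<delta> + \<alpha>) = m}"
proof -
  have mi: "monomial_ideal J" using assms by (simp add: strongly_stable_def)
  have W: "(\<delta>, \<alpha>) \<in> W J m \<longleftrightarrow> \<alpha> \<in> min_gens J \<and> deg (\<delta> + \<alpha>) = m" for \<delta> \<alpha>
    using mon_mono_dvd[OF mi, of \<alpha> "\<delta> + \<alpha>"]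
    by (auto simp: W_def min_gens_def mono_dvd_def lookup_add)
  have "(\<delta>, \<alpha>) \<in> star_pairs J" if V: "(\<delta>, \<alpha>) \<in> V J m" for \<delta> \<alpha>
  proof (rule ccontr)
    assume *: "(\<delta>, \<alpha>) \<notin> star_pairs J"
    have w: "(\<delta>, \<alpha>) \<in> W J m" using V by (simp add: V_def)
    then obtain \<epsilon> \<beta> where **: "(\<epsilon>, \<beta>) \<in> star_pairs J" "\<delta> + \<alpha> = \<epsilon> + \<beta>"
      using ex_star_pair[OF assms, of "\<delta> + \<alpha>"] by (auto simp: W_def)
    then have "(\<epsilon>, \<beta>) \<in> W J m" using w W by (auto simp: star_pairs_def)
    then have "W_greater (\<epsilon>, \<beta>) (\<delta>, \<alpha>)"
      using V ** * by (auto simp: V_def simp del: W_greater.simps)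
    then show False using star_pair_W_greater(2)[of \<epsilon> \<beta> J \<alpha> \<delta>] ** * w W by auto
  qed
  moreover have "(\<delta>, \<alpha>) \<in> V J m" if "(\<delta>, \<alpha>) \<in> star_pairs J" "deg (\<delta> + \<alpha>) = m" for \<delta> \<alpha>
    unfolding V_def
  proof (intro CollectI conjI ballI impI, goal_cases)
    case 1
    then show ?case using that W by (simp add: star_pairs_def)
  next
    case (2 w)
    obtain \<epsilon> \<beta> where w: "w = (\<epsilon>, \<beta>)" by (cases w)
    have "\<beta> \<in> min_gens J" using 2(1) W by (simp add: w)
    then show ?case
      using star_pair_W_greater(1)[OF that(1), of \<beta> \<epsilon>] 2(2) by (simp add: w del: W_greater.simps)
  qed
  moreover have "V J m \<subseteq> W J m" by (auto simp: V_def)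
  ultimately show ?thesis by (auto simp: W)
qed

section \<open>Reduction\<close>

text \<open>The predicate \<open>P\<close> allows bounds on multiplier and degree to be recorded, as
  the induction on multipliers requires.\<close>

definition star_span :: "('x::{finite,linorder}, 'k::comm_ring_1) mpoly set
    \<Rightarrow> ('x monomial \<Rightarrow> ('x, 'k) mpoly) \<Rightarrow> (('x monomial \<times> 'x monomial) \<Rightarrow> bool) \<Rightarrow> ('x, 'k) mpoly set"
  where "star_span J f P = kspan.span ((\<lambda>(\<delta>, \<alpha>). mon \<delta> * f \<alpha>) ` {w \<in> star_pairs J. P w})"

locale stable_J_set =
  fixes J :: "('x::{finite,linorder}, 'k::comm_ring_1) mpoly set"
    and f :: "'x monomial \<Rightarrow> ('x, 'k) mpoly"
  assumes stable: "strongly_stable J" and J_set: "J_set J f"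
begin

abbreviation "I \<equiv> ideal_of (f ` min_gens J)"

lemma monomial_ideal: "monomial_ideal J"
  using stable by (simp add: strongly_stable_def)

lemma not_min_gens_dvd: "\<gamma> \<in> sous_escalier J \<Longrightarrow> \<alpha> \<in> min_gens J \<Longrightarrow> \<not> mono_dvd \<alpha> \<gamma>"
  using mon_mono_dvd[OF monomial_ideal] by (auto simp: sous_escalier_def min_gens_def)

lemma mon_add_min_gens: "\<alpha> \<in> min_gens J \<Longrightarrow> mon (\<delta> + \<alpha>) \<in> J"
  by (rule mon_mono_dvd[OF monomial_ideal, of \<alpha>]) (simp_all add: min_gens_def mono_dvd_def lookup_add)

lemma mon_star_pair: "(\<delta>, \<alpha>) \<in> star_pairs J \<Longrightarrow> mon (\<delta> + \<alpha>) \<in> J"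
  by (simp add: star_pairs_def mon_add_min_gens)

lemma keys_tail:
  assumes "\<alpha> \<in> min_gens J" "\<beta> \<in> Poly_Mapping.keys (tail f (\<delta>, \<alpha>))"
  obtains \<gamma> where "\<gamma> \<in> sous_escalier J" "\<beta> = \<delta> + \<gamma>" "deg \<beta> = deg (\<delta> + \<alpha>)"
proof -
  have "tail f (\<delta>, \<alpha>) = mon \<delta> * (mon \<alpha> - f \<alpha>)"
    by (simp add: mon_add right_diff_distrib)
  then obtain \<gamma> where "\<gamma> \<in> Poly_Mapping.keys (mon \<alpha> - f \<alpha>)" "\<beta> = \<delta> + \<gamma>"
    using assms(2) keys_mon_mult[of \<delta> "mon \<alpha> - f \<alpha>"] by auto
  then show thesis
    using that J_set assms(1) by (auto simp: J_set_def deg_add)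
qed

text \<open>A tail monomial is \<delta> times some \<gamma> outside \<open>J\<close>, which no
  generator divides; this leaves only the first alternative of
  \<open>separated_lex_less_or_dvd\<close>.\<close>

lemma tail_star_less:
  assumes "\<alpha> \<in> min_gens J" "\<epsilon> + \<zeta> \<in> Poly_Mapping.keys (tail f (\<delta>, \<alpha>))" "(\<epsilon>, \<zeta>) \<in> star_pairs J"
  shows "lex_less \<epsilon> \<delta>"
proof -
  obtain \<gamma> where \<gamma>: "\<gamma> \<in> sous_escalier J" "\<epsilon> + \<zeta> = \<delta> + \<gamma>"
    using keys_tail[OF assms(1,2)] by metis
  then show ?thesis
    using separated_lex_less_or_dvd[of \<epsilon> \<zeta> \<delta> \<gamma>] not_min_gens_dvd[of \<gamma> \<zeta>] assms(3)
    by (auto simp: star_pairs_def)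
qed

lemma mon_mult_f: "mon \<delta> * f \<alpha> = mon (\<delta> + \<alpha>) - tail f (\<delta>, \<alpha>)"
  by simp

lemma homogeneous_mon_mult_f:
  assumes "\<alpha> \<in> min_gens J"
  shows "homogeneous (deg (\<delta> + \<alpha>)) (mon \<delta> * f \<alpha>)"
proof -
  have "homogeneous (deg (\<delta> + \<alpha>)) (tail f (\<delta>, \<alpha>))"
    unfolding homogeneous_def using keys_tail[OF assms] by blast
  then show ?thesis
    unfolding mon_mult_f by (intro homogeneous_diff homogeneous_mon)
qed

text \<open>Exchanging a head for its tail means subtracting a multiple of
  \<open>mon \<delta> * f \<alpha>\<close>; \<open>V_eq_star_pairs\<close> turns minimality into the
  star condition.\<close>

lemma Gss_step_iff:
  "Gss_step J f h h' \<longleftrightarrow> (\<exists>m \<delta> \<alpha>. homogeneous m h \<and> (\<delta>, \<alpha>) \<in> star_pairs J \<and>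
     \<delta> + \<alpha> \<in> Poly_Mapping.keys h \<and>
     h' = h - const (Poly_Mapping.lookup h (\<delta> + \<alpha>)) * (mon \<delta> * f \<alpha>))"
  (is "?L \<longleftrightarrow> ?R")
proof
  assume "Gss_step J f h h'"
  then obtain m \<beta> w where *: "homogeneous m h" "\<beta> \<in> Poly_Mapping.keys h" "w \<in> V J m" "head w = \<beta>"
    "h' = h - const (Poly_Mapping.lookup h \<beta>) * mon \<beta> + const (Poly_Mapping.lookup h \<beta>) * tail f w"
    unfolding Gss_step_def by blast
  obtain \<delta> \<alpha> where w: "w = (\<delta>, \<alpha>)" by (cases w)
  have "(\<delta>, \<alpha>) \<in> star_pairs J" using *(3) V_eq_star_pairs[OF stable] w by auto
  then show ?R
    using * w by (intro exI[of _ m] exI[of _ \<delta>] exI[of _ \<alpha>]) (auto simp: algebra_simps)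
next
  assume ?R
  then obtain m \<delta> \<alpha> where *: "homogeneous m h" "(\<delta>, \<alpha>) \<in> star_pairs J"
     "\<delta> + \<alpha> \<in> Poly_Mapping.keys h"
     "h' = h - const (Poly_Mapping.lookup h (\<delta> + \<alpha>)) * (mon \<delta> * f \<alpha>)"
    by blast
  have "deg (\<delta> + \<alpha>) = m" using *(1,3) by (simp add: homogeneous_def)
  then show ?L
    unfolding Gss_step_def using * mon_star_pair[OF *(2)] V_eq_star_pairs[OF stable, of m]
    by (intro exI[of _ m] exI[of _ "\<delta> + \<alpha>"] exI[of _ "(\<delta>, \<alpha>)"]) (auto simp: algebra_simps)
qed

section \<open>Invariants and termination of reduction\<close>

lemma Gss_step_homogeneous:
  assumes "Gss_step J f h h'" "homogeneous m h"
  shows "homogeneous m h'"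
proof -
  obtain \<delta> \<alpha> where *: "(\<delta>, \<alpha>) \<in> star_pairs J" "\<delta> + \<alpha> \<in> Poly_Mapping.keys h"
     "h' = h - const (Poly_Mapping.lookup h (\<delta> + \<alpha>)) * (mon \<delta> * f \<alpha>)"
    using assms(1) unfolding Gss_step_iff by blast
  then have "deg (\<delta> + \<alpha>) = m" using assms(2) by (simp add: homogeneous_def)
  then show ?thesis
    using * assms(2) homogeneous_mon_mult_f[of \<alpha> \<delta>] unfolding *(3)
    by (auto intro!: homogeneous_diff homogeneous_const_mult simp: star_pairs_def)
qed

lemma keys_Gss_step:
  assumes "(\<delta>, \<alpha>) \<in> star_pairs J"
  shows "Poly_Mapping.keys (h - const (Poly_Mapping.lookup h (\<delta> + \<alpha>)) * (mon \<delta> * f \<alpha>))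
    \<subseteq> (Poly_Mapping.keys h - {\<delta> + \<alpha>}) \<union> Poly_Mapping.keys (tail f (\<delta>, \<alpha>))"
proof
  let ?c = "Poly_Mapping.lookup h (\<delta> + \<alpha>)"
  fix \<beta> assume \<beta>: "\<beta> \<in> Poly_Mapping.keys (h - const ?c * (mon \<delta> * f \<alpha>))"
  show "\<beta> \<in> (Poly_Mapping.keys h - {\<delta> + \<alpha>}) \<union> Poly_Mapping.keys (tail f (\<delta>, \<alpha>))"
  proof (rule ccontr)
    assume "\<not> ?thesis"
    then have *: "Poly_Mapping.lookup h \<beta> = 0 \<or> \<beta> = \<delta> + \<alpha>"
      "Poly_Mapping.lookup (tail f (\<delta>, \<alpha>)) \<beta> = 0"
      by (auto simp: in_keys_iff simp del: tail.simps)
    have "Poly_Mapping.lookup (h - const ?c * (mon \<delta> * f \<alpha>)) \<beta> = 0"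
      unfolding mon_mult_f lookup_minus lookup_const_mult *(2)
      using *(1) by (auto simp: mon_def lookup_single when_def)
    then show False using \<beta> by (simp add: in_keys_iff)
  qed
qed

lemma Gss_step_in_ideal:
  assumes "(Gss_step J f)\<^sup>*\<^sup>* h h'"
  shows "h - h' \<in> I"
proof -
  interpret module "(*) :: ('x, 'k) mpoly \<Rightarrow> _ \<Rightarrow> _" by (rule module_times)
  show ?thesis using assms
  proof (induction rule: rtranclp_induct)
    case base
    then show ?case by (simp add: ideal_of_def span_zero)
  next
    case (step p q)
    then obtain c \<delta> \<alpha> where *: "(\<delta>, \<alpha>) \<in> star_pairs J" "q = p - c * (mon \<delta> * f \<alpha>)"
      unfolding Gss_step_iff by blast
    have "c * (mon \<delta> * f \<alpha>) \<in> I"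
      unfolding ideal_of_def using *(1)
      by (intro span_scale span_base imageI) (simp add: star_pairs_def)
    then have "(h - p) + c * (mon \<delta> * f \<alpha>) \<in> I"
      using step.IH unfolding ideal_of_def by (rule span_add[rotated])
    also have "(h - p) + c * (mon \<delta> * f \<alpha>) = h - q" unfolding *(2) by simp
    finally show ?case .
  qed
qed

text \<open>Heads created by a step come from a tail, so their multipliers lie below the one just
  used and the bound \<mu> persists. With \<open>h'\<close> zero, \<open>h\<close> itself is a
  combination of star elements below \<mu>.\<close>

lemma Gss_steps_in_star_span:
  assumes "(Gss_step J f)\<^sup>*\<^sup>* h h'" "homogeneous m h"
    "\<And>\<epsilon> \<zeta>. (\<epsilon>, \<zeta>) \<in> star_pairs J \<Longrightarrow> \<epsilon> + \<zeta> \<in> Poly_Mapping.keys h \<Longrightarrow> lex_less \<epsilon> \<mu>"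
  shows "h - h' \<in> star_span J f (\<lambda>(\<epsilon>, \<zeta>). lex_less \<epsilon> \<mu> \<and> deg (\<epsilon> + \<zeta>) = m)"
  using assms
\<comment> \<open>The bound concerns the initial polynomial, so the chain is unrolled from its start
  and the bound is passed on to the next polynomial.\<close>
proof (induction rule: converse_rtranclp_induct)
  case base
  then show ?case by (simp add: star_span_def kspan.span_zero)
next
  case (step h p)
  obtain \<delta> \<alpha> where *: "(\<delta>, \<alpha>) \<in> star_pairs J" "\<delta> + \<alpha> \<in> Poly_Mapping.keys h"
     "p = h - const (Poly_Mapping.lookup h (\<delta> + \<alpha>)) * (mon \<delta> * f \<alpha>)"
    using step.hyps(1) unfolding Gss_step_iff by blast
  have less: "lex_less \<delta> \<mu>" using step.prems(2) * by blast
  have deg: "deg (\<delta> + \<alpha>) = m" using step.prems(1) *(2) by (simp add: homogeneous_def)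
  have "p - h' \<in> star_span J f (\<lambda>(\<epsilon>, \<zeta>). lex_less \<epsilon> \<mu> \<and> deg (\<epsilon> + \<zeta>) = m)"
  proof (rule step.IH)
    show "homogeneous m p" using step.hyps(1) step.prems(1) by (rule Gss_step_homogeneous)
    fix \<epsilon> \<zeta> assume **: "(\<epsilon>, \<zeta>) \<in> star_pairs J" "\<epsilon> + \<zeta> \<in> Poly_Mapping.keys p"
    then consider "\<epsilon> + \<zeta> \<in> Poly_Mapping.keys h" | "\<epsilon> + \<zeta> \<in> Poly_Mapping.keys (tail f (\<delta>, \<alpha>))"
      using keys_Gss_step[OF *(1), of h] unfolding *(3) by blast
    then show "lex_less \<epsilon> \<mu>"
    proof cases
      case 1
      then show ?thesis using step.prems(2) **(1) by blast
    next
      case 2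
      then show ?thesis
        using tail_star_less[OF _ 2 **(1)] *(1) less lex_less_trans
        unfolding star_pairs_def by blast
    qed
  qed
  moreover have "const (Poly_Mapping.lookup h (\<delta> + \<alpha>)) * (mon \<delta> * f \<alpha>)
      \<in> star_span J f (\<lambda>(\<epsilon>, \<zeta>). lex_less \<epsilon> \<mu> \<and> deg (\<epsilon> + \<zeta>) = m)"
    unfolding star_span_def using *(1) less deg
    by (intro kspan.span_scale kspan.span_base) (auto intro!: image_eqI[of _ _ "(\<delta>, \<alpha>)"])
  ultimately have "(p - h') + const (Poly_Mapping.lookup h (\<delta> + \<alpha>)) * (mon \<delta> * f \<alpha>)
      \<in> star_span J f (\<lambda>(\<epsilon>, \<zeta>). lex_less \<epsilon> \<mu> \<and> deg (\<epsilon> + \<zeta>) = m)"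
    unfolding star_span_def by (rule kspan.span_add)
  then show ?case unfolding *(3) by (simp add: algebra_simps)
qed

text \<open>Termination: eliminate the heads with the lexicographically largest multiplier first.
  The set \<open>T\<close> contains the heads that may still occur; it is closed under the heads produced by
  reducing one of its elements.\<close>

lemma Gss_reduces_if_heads_in:
  assumes "finite T" "T \<subseteq> star_pairs J"
    and "\<And>\<delta> \<alpha> \<epsilon> \<zeta>. (\<delta>, \<alpha>) \<in> T \<Longrightarrow> (\<epsilon>, \<zeta>) \<in> star_pairs J \<Longrightarrow> deg (\<epsilon> + \<zeta>) = m \<Longrightarrow> lex_less \<epsilon> \<delta> \<Longrightarrow> (\<epsilon>, \<zeta>) \<in> T"
    and "homogeneous m h"
    and "\<And>w. w \<in> star_pairs J \<Longrightarrow> head w \<in> Poly_Mapping.keys h \<Longrightarrow> w \<in> T"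
  shows "\<exists>h\<^sub>0. Gss_reduces J f h h\<^sub>0"
  using assms
proof (induction "card T" arbitrary: T h)
  case 0
  \<comment> \<open>Every monomial of \<open>J\<close> is the head of a star pair, and for empty
    \<open>T\<close> no such head occurs in \<open>h\<close>.\<close>
  then have "Poly_Mapping.keys h \<subseteq> sous_escalier J"
    using ex_star_pair[OF stable] by (force simp: sous_escalier_def)
  then show ?case by (auto simp: Gss_reduces_def)
next
  case (Suc n)
  let ?less = "\<lambda>v w. lex_less (fst v) (fst w :: 'x monomial)"
  have "transp_on T ?less" "asymp_on T ?less" "T \<noteq> {}"
    using lex_less_trans lex_less_irrefl Suc.hyps(2) by (force intro!: transp_onI asymp_onI)+
  \<comment> \<open>Pairs with the same multiplier are incomparable, so only a maximal element is
    available.\<close>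
  then obtain w where "w \<in> T" "\<forall>v\<in>T. v \<noteq> w \<longrightarrow> \<not> ?less w v"
    using Finite_Set.bex_max_element[of T ?less] Suc.prems(1) by blast
  moreover obtain \<delta> \<alpha> where w: "w = (\<delta>, \<alpha>)" by (cases w)
  ultimately have \<delta>\<alpha>: "(\<delta>, \<alpha>) \<in> T" and max: "\<And>\<epsilon> \<zeta>. (\<epsilon>, \<zeta>) \<in> T \<Longrightarrow> \<not> lex_less \<delta> \<epsilon>"
    using lex_less_irrefl by force+
  have star: "(\<delta>, \<alpha>) \<in> star_pairs J" using \<delta>\<alpha> Suc.prems(2) by blast
  let ?T = "T - {(\<delta>, \<alpha>)}"
  have n: "n = card ?T" using Suc.hyps(2) \<delta>\<alpha> by simp
  have T: "finite ?T" "?T \<subseteq> star_pairs J" using Suc.prems(1,2) by auto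
  \<comment> \<open>Maximality ensures that the removed pair is not below any remaining one.\<close>
  have closed: "(\<epsilon>', \<zeta>') \<in> ?T" if "(\<epsilon>, \<zeta>) \<in> ?T" "(\<epsilon>', \<zeta>') \<in> star_pairs J"
    "deg (\<epsilon>' + \<zeta>') = m" "lex_less \<epsilon>' \<epsilon>" for \<epsilon> \<zeta> \<epsilon>' \<zeta>'
    using that Suc.prems(3)[of \<epsilon> \<zeta> \<epsilon>' \<zeta>'] max[of \<epsilon> \<zeta>] by auto
  show ?case
  proof (cases "\<delta> + \<alpha> \<in> Poly_Mapping.keys h")
    case False
    then have in_T: "v \<in> ?T" if "v \<in> star_pairs J" "head v \<in> Poly_Mapping.keys h" for v
      using that Suc.prems(5)[of v] by auto
    show ?thesis
      by (rule Suc.hyps(1)[OF n T _ Suc.prems(4)]) (fact closed in_T)+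
  next
    case True
    define p where "p = h - const (Poly_Mapping.lookup h (\<delta> + \<alpha>)) * (mon \<delta> * f \<alpha>)"
    have step: "Gss_step J f h p"
      unfolding Gss_step_iff p_def using Suc.prems(4) star True by blast
    have p: "homogeneous m p" using step Suc.prems(4) by (rule Gss_step_homogeneous)
    have in_T: "v \<in> ?T" if v: "v \<in> star_pairs J" "head v \<in> Poly_Mapping.keys p" for v
    proof -
      obtain \<epsilon> \<zeta> where v_eq: "v = (\<epsilon>, \<zeta>)" by (cases v)
      have "deg (\<epsilon> + \<zeta>) = m" using p v(2) by (simp add: homogeneous_def v_eq)
      consider "\<epsilon> + \<zeta> \<in> Poly_Mapping.keys h" "\<epsilon> + \<zeta> \<noteq> \<delta> + \<alpha>"
        | "\<epsilon> + \<zeta> \<in> Poly_Mapping.keys (tail f (\<delta>, \<alpha>))"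
        using keys_Gss_step[OF star, of h] v(2) unfolding p_def v_eq by auto
      then show ?thesis
      proof cases
        case 1
        then show ?thesis using Suc.prems(5)[OF v(1)] by (auto simp: v_eq)
      next
        case 2
        then have "lex_less \<epsilon> \<delta>"
          using tail_star_less v(1) star by (auto simp: v_eq star_pairs_def)
        then show ?thesis
          using Suc.prems(3)[OF \<delta>\<alpha>] v(1) \<open>deg (\<epsilon> + \<zeta>) = m\<close> lex_less_irrefl by (auto simp: v_eq)
      qed
    qed
    have "\<exists>h\<^sub>0. Gss_reduces J f p h\<^sub>0"
      by (rule Suc.hyps(1)[OF n T _ p]) (fact closed in_T)+
    then show ?thesis
      using step by (meson Gss_reduces_def converse_rtranclp_into_rtranclp)
  qed
qed

lemma ex_Gss_reduces:
  assumes "homogeneous m h"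
  shows "\<exists>h\<^sub>0. Gss_reduces J f h h\<^sub>0"
proof (rule Gss_reduces_if_heads_in)
  let ?T = "{(\<delta>, \<alpha>) \<in> star_pairs J. deg (\<delta> + \<alpha>) = m}"
  have "?T \<subseteq> {\<delta>. deg \<delta> \<le> m} \<times> {\<alpha>. deg \<alpha> \<le> m}" by (auto simp: deg_add)
  then show "finite ?T" using finite_deg_le finite_subset by blast
  show "w \<in> ?T" if "w \<in> star_pairs J" "head w \<in> Poly_Mapping.keys h" for w
    using that assms by (cases w) (auto simp: homogeneous_def)
qed (use assms in auto)

section \<open>The marked basis criterion\<close>

lemma homogeneous_S_poly:
  assumes "\<alpha> \<in> min_gens J" "\<beta> \<in> min_gens J"
  shows "homogeneous (deg (mono_lcm \<alpha> \<beta>)) (S_poly f \<alpha> \<beta>)"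
  using homogeneous_mon_mult_f[OF assms(1), of "mono_lcm \<alpha> \<beta> - \<alpha>"]
    homogeneous_mon_mult_f[OF assms(2), of "mono_lcm \<alpha> \<beta> - \<beta>"]
  by (simp add: S_poly_def mono_dvd_add mono_dvd_lcm homogeneous_diff)

lemma S_poly_in_ideal:
  assumes "\<alpha> \<in> min_gens J" "\<beta> \<in> min_gens J"
  shows "S_poly f \<alpha> \<beta> \<in> I"
  unfolding S_poly_def ideal_of_def using assms
  by (intro module.span_diff[OF module_times] module.span_scale[OF module_times]
      module.span_base[OF module_times]) auto

text \<open>Some reduction ends outside \<open>J\<close>. Its result is congruent to the
  S-polynomial and thus lies in \<open>I\<close>, so independence of the monomials outside
  \<open>J\<close> makes it zero.\<close>

lemma S_poly_reduces:
  assumes "quotient_basis (sous_escalier J) I" "\<alpha> \<in> min_gens J" "\<beta> \<in> min_gens J"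
  shows "Gss_reduces J f (S_poly f \<alpha> \<beta>) 0"
proof -
  obtain h\<^sub>0 where h\<^sub>0: "Gss_reduces J f (S_poly f \<alpha> \<beta>) h\<^sub>0"
    using ex_Gss_reduces homogeneous_S_poly assms(2,3) by blast
  then have "S_poly f \<alpha> \<beta> - h\<^sub>0 \<in> I"
    using Gss_step_in_ideal by (simp add: Gss_reduces_def)
  then have "S_poly f \<alpha> \<beta> - (S_poly f \<alpha> \<beta> - h\<^sub>0) \<in> I"
    using S_poly_in_ideal[OF assms(2,3)] module.span_diff[OF module_times] unfolding ideal_of_def by blast
  then have "h\<^sub>0 = 0"
    using assms(1) h\<^sub>0 by (simp add: quotient_basis_iff Gss_reduces_def)
  then show ?thesis using h\<^sub>0 by simp
qed

lemma homogeneous_ideal_I: "homogeneous_ideal I"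
  unfolding homogeneous_ideal_def
proof (intro exI[of _ "f ` min_gens J"] conjI ballI)
  fix h assume "h \<in> f ` min_gens J"
  then obtain \<alpha> where "\<alpha> \<in> min_gens J" "h = f \<alpha>" by blast
  then show "\<exists>m. homogeneous m h"
    using homogeneous_mon_mult_f[of \<alpha> 0] by (auto simp: mon_def)
qed (rule refl)

text \<open>Termination gives the spanning half of \<open>quotient_basis\<close>. Steps act on
  homogeneous polynomials, so monomials are reduced one by one and the results combined
  linearly.\<close>

lemma ex_normal_form: "\<exists>q. Poly_Mapping.keys q \<subseteq> sous_escalier J \<and> p - q \<in> I"
proof -
  interpret ideal: module "(*) :: ('x, 'k) mpoly \<Rightarrow> _ \<Rightarrow> _" by (rule module_times)
  have "\<exists>q. Poly_Mapping.keys q \<subseteq> sous_escalier J \<and> mon \<beta> - q \<in> I" for \<beta>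
    using ex_Gss_reduces[OF homogeneous_mon] Gss_step_in_ideal by (metis Gss_reduces_def)
  then obtain q where q: "\<And>\<beta>. Poly_Mapping.keys (q \<beta>) \<subseteq> sous_escalier J" "\<And>\<beta>. mon \<beta> - q \<beta> \<in> I"
    by metis
  let ?q = "\<Sum>\<beta>\<in>Poly_Mapping.keys p. const (Poly_Mapping.lookup p \<beta>) * q \<beta>"
  have "Poly_Mapping.keys ?q \<subseteq> sous_escalier J"
    using keys_sum[of "\<lambda>\<beta>. const (Poly_Mapping.lookup p \<beta>) * q \<beta>" "Poly_Mapping.keys p"]
      keys_const_mult q(1) by fastforce
  moreover have "p - ?q = (\<Sum>\<beta>\<in>Poly_Mapping.keys p. const (Poly_Mapping.lookup p \<beta>) * (mon \<beta> - q \<beta>))"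
    by (subst (1) poly_eq_sum_monomials[of p]) (simp add: right_diff_distrib sum_subtractf)
  then have "p - ?q \<in> I"
    using q(2) by (simp add: ideal_of_def ideal.span_sum ideal.span_scale)
  ultimately show ?thesis by blast
qed

text \<open>The coefficient at a head with lexicographically maximal multiplier cannot cancel.\<close>

lemma star_span_independent:
  assumes q: "q \<in> star_span J f (\<lambda>_. True)" and keys: "Poly_Mapping.keys q \<subseteq> sous_escalier J"
  shows "q = 0"
proof -
  let ?g = "\<lambda>(\<delta>, \<alpha>). mon \<delta> * f \<alpha>"
  obtain T r where T: "finite T" "T \<subseteq> ?g ` star_pairs J" "q = (\<Sum>a\<in>T. const (r a) * a)"
    using q unfolding star_span_def kspan.span_explicit by auto
  \<comment> \<open>One pair is chosen per polynomial of \<open>T\<close>, which indexes the sum by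
    pairs with comparable data.\<close>
  obtain D where D: "D \<subseteq> star_pairs J" "inj_on ?g D" "T = ?g ` D"
    using T(2) unfolding subset_image_inj by blast
  have finD: "finite D" using T(1) D(2,3) finite_imageD by blast
  define c where "c w = r (?g w)" for w
  \<comment> \<open>Zero coefficients are dropped so that the coefficient at the maximal head is
    nonzero.\<close>
  let ?D = "{w \<in> D. c w \<noteq> 0}"
  have "q = (\<Sum>w\<in>D. const (c w) * ?g w)"
    unfolding T(3) D(3) c_def using D(2) by (simp add: sum.reindex)
  also have "\<dots> = (\<Sum>w\<in>?D. const (c w) * ?g w)"
    using finD by (intro sum.mono_neutral_right) (auto simp: const_def)
  finally have q_eq: "q = (\<Sum>w\<in>?D. const (c w) * ?g w)" .
  show ?thesis
  proof (cases "?D = {}")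
    case True
    then show ?thesis unfolding q_eq by (simp only: sum.empty)
  next
    case False
    let ?less = "\<lambda>v w. lex_less (fst v) (fst w :: 'x monomial)"
    have "transp_on ?D ?less" "asymp_on ?D ?less"
      using lex_less_trans lex_less_irrefl by (blast intro!: transp_onI asymp_onI)+
    then obtain w where "w \<in> ?D" "\<forall>v\<in>?D. v \<noteq> w \<longrightarrow> \<not> ?less w v"
      using Finite_Set.bex_max_element[of ?D ?less] finD False by auto
    moreover obtain \<delta> \<alpha> where w: "w = (\<delta>, \<alpha>)" by (cases w)
    ultimately have \<delta>\<alpha>: "(\<delta>, \<alpha>) \<in> ?D" and max: "\<And>\<epsilon> \<zeta>. (\<epsilon>, \<zeta>) \<in> ?D \<Longrightarrow> \<not> lex_less \<delta> \<epsilon>"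
      using lex_less_irrefl by force+
    have star: "(\<delta>, \<alpha>) \<in> star_pairs J" using \<delta>\<alpha> D(1) by blast
    \<comment> \<open>Another star element has a different head by uniqueness, and its tail could
      contain this head only if its multiplier were larger than \<delta>.\<close>
    have lookup: "Poly_Mapping.lookup (mon \<epsilon> * f \<zeta>) (\<delta> + \<alpha>) = (if (\<epsilon>, \<zeta>) = (\<delta>, \<alpha>) then 1 else 0)"
      if "(\<epsilon>, \<zeta>) \<in> ?D" for \<epsilon> \<zeta>
    proof -
      have *: "(\<epsilon>, \<zeta>) \<in> star_pairs J" using that D(1) by blast
      have "\<delta> + \<alpha> \<notin> Poly_Mapping.keys (tail f (\<epsilon>, \<zeta>))"
        using tail_star_less[OF _ _ star] max[OF that] * by (auto simp: star_pairs_def)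
      then have "Poly_Mapping.lookup (tail f (\<epsilon>, \<zeta>)) (\<delta> + \<alpha>) = 0"
        by (simp add: in_keys_iff del: tail.simps)
      then show ?thesis
        using star_pairs_unique[OF * star] unfolding mon_mult_f lookup_minus
        by (auto simp: mon_def lookup_single when_def)
    qed
    have "Poly_Mapping.lookup q (\<delta> + \<alpha>) = (\<Sum>w\<in>?D. c w * (if w = (\<delta>, \<alpha>) then 1 else 0))"
      unfolding q_eq lookup_sum lookup_const_mult
      by (intro sum.cong refl arg_cong2[of _ _ _ _ "(*)"], clarify) (use lookup in simp)
    also have "\<dots> = c (\<delta>, \<alpha>)"
      using \<delta>\<alpha> finD by (simp add: if_distrib[of "(*) _"] cong: if_cong)
    finally have "\<delta> + \<alpha> \<in> Poly_Mapping.keys q" using \<delta>\<alpha> by (simp add: in_keys_iff)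
    then show ?thesis
      using keys mon_star_pair[OF star] by (auto simp: sous_escalier_def)
  qed
qed

text \<open>The heads cancel, leaving a difference of two tails. Their star multipliers lie below
  the respective cofactors of the least common multiple, and the cofactor of \<alpha> is the larger
  one.\<close>

lemma keys_S_poly_star_less:
  assumes \<alpha>: "\<alpha> \<in> min_gens J" and \<beta>: "\<beta> \<in> min_gens J"
    and less: "lex_less (mono_lcm \<alpha> \<beta> - \<beta>) (mono_lcm \<alpha> \<beta> - \<alpha>)"
    and star: "(\<epsilon>, \<zeta>) \<in> star_pairs J" and key: "\<epsilon> + \<zeta> \<in> Poly_Mapping.keys (S_poly f \<alpha> \<beta>)"
  shows "lex_less \<epsilon> (mono_lcm \<alpha> \<beta> - \<alpha>)"
proof -
  let ?\<mu> = "mono_lcm \<alpha> \<beta> - \<alpha>" and ?\<nu> = "mono_lcm \<alpha> \<beta> - \<beta>"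
  have "S_poly f \<alpha> \<beta> = tail f (?\<nu>, \<beta>) - tail f (?\<mu>, \<alpha>)"
    by (simp add: S_poly_def mono_dvd_add mono_dvd_lcm)
  then consider "\<epsilon> + \<zeta> \<in> Poly_Mapping.keys (tail f (?\<nu>, \<beta>))"
    | "\<epsilon> + \<zeta> \<in> Poly_Mapping.keys (tail f (?\<mu>, \<alpha>))"
    using key keys_diff[of "tail f (?\<nu>, \<beta>)" "tail f (?\<mu>, \<alpha>)"] by (auto simp del: tail.simps)
  then show ?thesis
    using tail_star_less[OF \<beta> _ star] tail_star_less[OF \<alpha> _ star] less lex_less_trans by cases blast+
qed

text \<open>Induction on the multiplier: if \<open>X\<^sup>\<delta> f\<^sub>\<alpha>\<close> is not the star element \<open>X\<^sup>\<epsilon> f\<^sub>\<beta>\<close> with the same head, then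
  their difference is a multiple of an S-polynomial, whose reduction to zero only involves
  multipliers below \<open>\<delta>\<close>.\<close>

lemma mult_f_in_star_span:
  assumes S: "\<And>\<alpha> \<beta>. \<alpha> \<in> min_gens J \<Longrightarrow> \<beta> \<in> min_gens J \<Longrightarrow> Gss_reduces J f (S_poly f \<alpha> \<beta>) 0"
    and "\<alpha> \<in> min_gens J"
  shows "mon \<delta> * f \<alpha> \<in> star_span J f (\<lambda>_. True)"
proof -
  define m where "m = deg (\<delta> + \<alpha>)"
  \<comment> \<open>The degree bound leaves finitely many multipliers, and a strict partial order on
    a finite set is well-founded.\<close>
  have "wfp_on {\<delta> :: 'x monomial. deg \<delta> \<le> m} lex_less"
    using lex_less_trans lex_less_irrefl
    by (intro strict_partial_order_wfp_on_finite_set finite_deg_le) (blast intro!: transp_onI asymp_onI)+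
  then show ?thesis using assms(2) m_def[symmetric]
  proof (induction \<delta> arbitrary: \<alpha> rule: wfp_on_induct)
    case in_set
    show ?case by (simp add: m_def deg_add)
  next
    case (less \<delta>)
    note \<alpha> = less.prems(1)
    have "mon (\<delta> + \<alpha>) \<in> J"
      using \<alpha> by (rule mon_add_min_gens)
    then obtain \<epsilon> \<beta> where star: "(\<epsilon>, \<beta>) \<in> star_pairs J" and eq: "\<delta> + \<alpha> = \<epsilon> + \<beta>"
      using ex_star_pair[OF stable] by blast
    then have \<beta>: "\<beta> \<in> min_gens J" by (simp add: star_pairs_def)
    have base: "mon \<epsilon> * f \<beta> \<in> star_span J f (\<lambda>_. True)"
      unfolding star_span_def using star
      by (intro kspan.span_base) (auto intro!: image_eqI[of _ _ "(\<epsilon>, \<beta>)"])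
    show ?case
    proof (cases "lex_less \<epsilon> \<delta>")
      \<comment> \<open>Here \<beta> divides \<alpha>, so the given pair is already the star
        pair.\<close>
      case False
      then have "\<beta> = \<alpha>"
        using separated_lex_less_or_dvd[of \<epsilon> \<beta> \<delta> \<alpha>] star eq \<alpha> min_gens_dvd_eq
        by (auto simp: star_pairs_def)
      then show ?thesis using base eq by simp
    next
      case True
      let ?L = "mono_lcm \<alpha> \<beta>"
      \<comment> \<open>Both \<delta> and \<epsilon> contain the cofactor \<eta> of the least common
        multiple in the common head; cancelling it leaves the multipliers of the
        S-polynomial.\<close>
      define \<eta> where "\<eta> = \<delta> + \<alpha> - ?L"
      have "mono_dvd ?L (\<delta> + \<alpha>)"
      proof (rule mono_lcm_least)
        show "mono_dvd \<alpha> (\<delta> + \<alpha>)" by (simp add: mono_dvd_def lookup_add)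
        show "mono_dvd \<beta> (\<delta> + \<alpha>)" unfolding eq by (simp add: mono_dvd_def lookup_add)
      qed
      then have \<eta>: "\<delta> + \<alpha> = \<eta> + ?L" unfolding \<eta>_def by (rule mono_dvd_add[symmetric])
      have \<delta>: "\<delta> = \<eta> + (?L - \<alpha>)"
      proof -
        have "\<delta> + \<alpha> = \<eta> + (?L - \<alpha>) + \<alpha>"
          unfolding \<eta> add.assoc mono_dvd_add[OF mono_dvd_lcm(1)] ..
        then show ?thesis by simp
      qed
      have \<epsilon>: "\<epsilon> = \<eta> + (?L - \<beta>)"
      proof -
        have "\<epsilon> + \<beta> = \<eta> + (?L - \<beta>) + \<beta>"
          unfolding eq[symmetric] \<eta> add.assoc mono_dvd_add[OF mono_dvd_lcm(2)] ..
        then show ?thesis by simp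
      qed
      let ?P = "\<lambda>(\<epsilon>, \<zeta>). lex_less \<epsilon> (?L - \<alpha>) \<and> deg (\<epsilon> + \<zeta>) = deg ?L"
      have "lex_less (?L - \<beta>) (?L - \<alpha>)"
        using True unfolding \<delta> \<epsilon> lex_less_add_iff .
      then have "S_poly f \<alpha> \<beta> - 0 \<in> star_span J f ?P"
        using S[OF \<alpha> \<beta>] homogeneous_S_poly[OF \<alpha> \<beta>] keys_S_poly_star_less[OF \<alpha> \<beta>]
        by (intro Gss_steps_in_star_span) (auto simp: Gss_reduces_def)
      then have "S_poly f \<alpha> \<beta> \<in> star_span J f ?P" by simp
      then have "mon \<eta> * S_poly f \<alpha> \<beta> \<in> star_span J f (\<lambda>_. True)"
        unfolding star_span_def[of _ _ ?P]
      proof (induction rule: kspan.span_induct_alt)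
        case base
        then show ?case by (simp add: star_span_def kspan.span_zero)
      next
        case (step c x y)
        then obtain \<iota> \<zeta> where *: "(\<iota>, \<zeta>) \<in> star_pairs J" "lex_less \<iota> (?L - \<alpha>)"
          "deg (\<iota> + \<zeta>) = deg ?L" "x = mon \<iota> * f \<zeta>" by auto
        \<comment> \<open>Multiplication by \<eta> may destroy the star property, but the new
          multiplier stays below \<delta> in the same degree, so the induction hypothesis
          applies.\<close>
        have "deg (\<eta> + \<iota> + \<zeta>) = m"
          using *(3) \<eta> less.prems(2) by (simp add: deg_add)
        moreover have "lex_less (\<eta> + \<iota>) \<delta>"
          using *(2) by (subst \<delta>) (simp add: lex_less_add_iff)
        ultimately have "mon (\<eta> + \<iota>) * f \<zeta> \<in> star_span J f (\<lambda>_. True)"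
          using less.IH[of "\<eta> + \<iota>" \<zeta>] *(1) by (auto simp: deg_add star_pairs_def)
        then have "const c * (mon (\<eta> + \<iota>) * f \<zeta>) + mon \<eta> * y \<in> star_span J f (\<lambda>_. True)"
          using step(2) unfolding star_span_def by (intro kspan.span_add kspan.span_scale)
        then show ?case unfolding *(4) by (simp add: mon_add algebra_simps)
      qed
      then have "mon \<eta> * S_poly f \<alpha> \<beta> + mon \<epsilon> * f \<beta> \<in> star_span J f (\<lambda>_. True)"
        using base unfolding star_span_def by (rule kspan.span_add)
      moreover have "mon \<delta> * f \<alpha> = mon \<eta> * S_poly f \<alpha> \<beta> + mon \<epsilon> * f \<beta>"
        by (subst \<delta>, subst \<epsilon>) (simp add: S_poly_def mon_add algebra_simps)
      ultimately show ?thesis by simp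
    qed
  qed
qed

text \<open>Splitting the polynomial coefficients of an ideal element into monomials leaves scalar
  multiples of the products treated by \<open>mult_f_in_star_span\<close>.\<close>

lemma ideal_subset_star_span:
  assumes S: "\<And>\<alpha> \<beta>. \<alpha> \<in> min_gens J \<Longrightarrow> \<beta> \<in> min_gens J \<Longrightarrow> Gss_reduces J f (S_poly f \<alpha> \<beta>) 0"
  shows "I \<subseteq> star_span J f (\<lambda>_. True)"
proof
  fix p assume "p \<in> I"
  then obtain F r where F: "F \<subseteq> f ` min_gens J" "p = (\<Sum>a\<in>F. r a * a)"
    unfolding ideal_of_explicit by blast
  have "s * f \<alpha> \<in> star_span J f (\<lambda>_. True)" if "\<alpha> \<in> min_gens J" for s \<alpha>
  proof -
    have "s * f \<alpha> = (\<Sum>\<delta>\<in>Poly_Mapping.keys s. const (Poly_Mapping.lookup s \<delta>) * (mon \<delta> * f \<alpha>))"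
      by (subst poly_eq_sum_monomials[of s]) (simp add: sum_distrib_right mult.assoc)
    then show ?thesis
      using mult_f_in_star_span[OF S that]
      by (simp add: star_span_def kspan.span_sum kspan.span_scale)
  qed
  then show "p \<in> star_span J f (\<lambda>_. True)"
    using F unfolding star_span_def by (auto intro!: kspan.span_sum)
qed

end

theorem theorem17:
  fixes J I :: "('x::{finite,linorder}, 'k::alg_closed_field) mpoly set"
    and f :: "'x monomial \<Rightarrow> ('x, 'k) mpoly"
  assumes "strongly_stable J"
    and "J_set J f"
    and "I = ideal_of (f ` min_gens J)"
  shows "I \<in> BSt J \<longleftrightarrow>
    (\<forall>\<alpha>\<in>min_gens J. \<forall>\<alpha>'\<in>min_gens J. Gss_reduces J f (S_poly f \<alpha> \<alpha>') 0)"
proof -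
  interpret stable_J_set J f by unfold_locales fact+
  show ?thesis
    \<comment> \<open>Homogeneity and spanning being established, the converse only needs
      independence, which passes from the star span to the ideal contained in it.\<close>
    unfolding assms(3) BSt_def
    using S_poly_reduces homogeneous_ideal_I ex_normal_form star_span_independent
      ideal_subset_star_span
    by (auto simp: quotient_basis_iff) blast
qed

end
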